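(* For every $n\in\mathbb{N}$, the domain $B_{\ell_1^n}=\{z\in\mathbb{C}^n:\sum_{j=1}^n|z_j|<1\}$ is $0$-uniformly pseudoconvex.
   Context: $bU$ denotes the boundary of $U$. Uniformly plurisubharmonic on average: for $U\subset\mathbb{C}^n$ open and $L>0$, an upper semicontinuous $g:U\to[-\infty,\infty)$ is $L$-uniformly plurisubharmonic on average if there is a lower semicontinuous $\delta:U\to(0,\infty)$ such that for all $a\in U$ and $b\in\mathbb{C}^n$ with $\|b\|<\delta(a)$ (where $\delta(a)$ is small enough that the closed disk $a+\overline{\mathbb{D}}b$ lies in $U$), $$L\|b\|^2+g(a)\le\frac1{2\pi}\int_0^{2\pi}g(a+e^{i\theta}b)\,d\theta.$$ $0$-uniformly pseudoconvex: a relatively compact domain $U\Subset\mathbb{C}^n$ is $0$-uniformly pseudoconvex if there exist positive constants $L,M,M'$, bounded neighborhoods $V_1,V_2$ of $bU$ with $V_2\supset\overline{V_1}$, and a function $r:V_2\to\mathbb{R}$ such that $U\cap V_2=\{z\in V_2:r(z)<0\}$ and $r$ is the (pointwise) limit on $V_2$ of a sequence $\{r_m\}$ of pointwise bounded $C^1$ functions $r_m:V_2\to\mathbb{R}$ such that each $r_m$ is $L$-uniformly plurisubharmonic on average on $V_2$ and $M'\ge\|\nabla r_m(z)\|\ge M$ for all $z\in\overline{V_1}$ and all $m$. *)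

theory Defs
  imports "HOL-Analysis.Analysis"
begin

definition usc_on :: "'a::topological_space set \<Rightarrow> ('a \<Rightarrow> 'b::order) \<Rightarrow> bool" where
  "usc_on U g \<longleftrightarrow> (\<forall>c. openin (top_of_set U) {z \<in> U. g z < c})"

definition lsc_on :: "'a::topological_space set \<Rightarrow> ('a \<Rightarrow> 'b::order) \<Rightarrow> bool" where
  "lsc_on U g \<longleftrightarrow> (\<forall>c. openin (top_of_set U) {z \<in> U. c < g z})"

(* Integral of the positive part minus integral of the negative part (e2ennreal sends negative
   arguments to 0).  An upper semicontinuous function with values in [-\<infinity>,\<infinity>) is bounded above on
   a compact set, so below the first term is finite and the value is the usual one, possibly -\<infinity>. *)
definition ereal_integral :: "'a measure \<Rightarrow> ('a \<Rightarrow> ereal) \<Rightarrow> ereal" where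
  "ereal_integral M f =
     enn2ereal (\<integral>\<^sup>+ x. e2ennreal (f x) \<partial>M) - enn2ereal (\<integral>\<^sup>+ x. e2ennreal (- f x) \<partial>M)"

definition circle_mean :: "(complex ^ 'n \<Rightarrow> ereal) \<Rightarrow> complex ^ 'n \<Rightarrow> complex ^ 'n \<Rightarrow> ereal" where
  "circle_mean g a b =
     ereal (1 / (2 * pi)) *
       ereal_integral (restrict_space lborel {0..2 * pi}) (\<lambda>\<theta>. g (a + cis \<theta> *s b))"

(* The norm on complex ^ 'n is the Euclidean one, and *s is multiplication by complex scalars. *)
definition uniformly_psh_on_average ::
    "real \<Rightarrow> (complex ^ 'n) set \<Rightarrow> (complex ^ 'n \<Rightarrow> ereal) \<Rightarrow> bool" where
  "uniformly_psh_on_average L U g \<longleftrightarrow>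
     open U \<and> L > 0 \<and> (\<forall>z\<in>U. g z < \<infinity>) \<and> usc_on U g \<and>
     (\<exists>\<delta> :: complex ^ 'n \<Rightarrow> real. lsc_on U \<delta> \<and> (\<forall>a\<in>U. \<delta> a > 0) \<and>
        (\<forall>a\<in>U. \<forall>b. norm b < \<delta> a \<longrightarrow>
           (\<lambda>\<zeta>. a + \<zeta> *s b) ` cball 0 1 \<subseteq> U \<and>
           ereal (L * (norm b)\<^sup>2) + g a \<le> circle_mean g a b))"

(* The real gradient, with respect to the real inner product Re <z,w> on complex ^ 'n. *)
definition gradient :: "('a::real_inner \<Rightarrow> real) \<Rightarrow> 'a \<Rightarrow> 'a" where
  "gradient f z = (THE D. GDERIV f z :> D)"

(* Intended for open S only: differentiability is taken at z, not within S. *)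
definition C1_on :: "'a::real_inner set \<Rightarrow> ('a \<Rightarrow> real) \<Rightarrow> bool" where
  "C1_on S f \<longleftrightarrow> (\<forall>z\<in>S. f differentiable (at z)) \<and> continuous_on S (gradient f)"

definition zero_uniformly_pseudoconvex :: "(complex ^ 'n) set \<Rightarrow> bool" where
  "zero_uniformly_pseudoconvex U \<longleftrightarrow>
     open U \<and> connected U \<and> U \<noteq> {} \<and> compact (closure U) \<and>
     (\<exists>(L::real) (M::real) (M'::real) V\<^sub>1 V\<^sub>2 (r :: complex ^ 'n \<Rightarrow> real)
        (rs :: nat \<Rightarrow> complex ^ 'n \<Rightarrow> real).
        L > 0 \<and> M > 0 \<and> M' > 0 \<and>
        open V\<^sub>1 \<and> bounded V\<^sub>1 \<and> frontier U \<subseteq> V\<^sub>1 \<and>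
        open V\<^sub>2 \<and> bounded V\<^sub>2 \<and> frontier U \<subseteq> V\<^sub>2 \<and>
        closure V\<^sub>1 \<subseteq> V\<^sub>2 \<and>
        U \<inter> V\<^sub>2 = {z \<in> V\<^sub>2. r z < 0} \<and>
        (\<forall>z\<in>V\<^sub>2. bounded (range (\<lambda>m. rs m z))) \<and>
        (\<forall>z\<in>V\<^sub>2. (\<lambda>m. rs m z) \<longlonglongrightarrow> r z) \<and>
        (\<forall>m. C1_on V\<^sub>2 (rs m) \<and>
             uniformly_psh_on_average L V\<^sub>2 (\<lambda>z. ereal (rs m z)) \<and>
             (\<forall>z\<in>closure V\<^sub>1. M \<le> norm (gradient (rs m) z) \<and> norm (gradient (rs m) z) \<le> M')))"

end

theory Submission
  imports Defs
begin

text \<open>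
  The defining function of the ball is \<open>r z = (\<Sum>j. \<bar>z\<^sub>j\<bar>) - 1\<close>. It is neither smooth nor strictly
  convex, but it is uniformly plurisubharmonic on bounded sets: the function \<open>\<bar>w\<bar>\<close> on the complex
  plane has Laplacian \<open>1 / \<bar>w\<bar>\<close> off the origin, which is bounded below where \<open>\<bar>w\<bar>\<close> is bounded.
  The smooth approximants \<open>(\<Sum>j. sqrt (\<bar>z\<^sub>j\<bar>\<^sup>2 + e\<^sup>2)) - 1\<close>, as \<open>e\<close> decreases to 0, inherit this with a
  constant independent of \<open>e\<close>, since the Laplacian of \<open>sqrt (\<bar>w\<bar>\<^sup>2 + e\<^sup>2)\<close> is at least
  \<open>1 / sqrt (\<bar>w\<bar>\<^sup>2 + e\<^sup>2)\<close>. Only the radius \<open>\<delta>\<close> up to which the mean value inequality is claimed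
  depends on \<open>e\<close>; the definition permits this, as each approximant may have its own \<open>\<delta>\<close>.

  The mean value inequality is obtained without second derivatives. On the circle \<open>a + cis \<theta> * b\<close>
  the number \<open>\<bar>a + cis \<theta> * b\<bar>\<^sup>2 + e\<^sup>2\<close> differs from \<open>s\<^sup>2 = \<bar>a\<bar>\<^sup>2 + e\<^sup>2\<close> by a trigonometric polynomial
  \<open>t\<close> of mean \<open>\<bar>b\<bar>\<^sup>2\<close>, whose square has mean \<open>2 \<bar>a\<bar>\<^sup>2 \<bar>b\<bar>\<^sup>2 + \<bar>b\<bar>\<^sup>4\<close>. The exact Taylor
  coefficients of the square root give, to leading order, the gain
  \<open>\<bar>b\<bar>\<^sup>2 / (2 s) - 2 \<bar>a\<bar>\<^sup>2 \<bar>b\<bar>\<^sup>2 / (8 s\<^sup>3)\<close>. A local quadratic minorant of the square root whose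
  second coefficient lies below \<open>1/4\<close> in place of \<open>1/8\<close> still leaves, for small \<open>b\<close>, a positive
  multiple of \<open>\<bar>b\<bar>\<^sup>2 / s\<close>
  (\<open>sqrt_ge_taylor2\<close>, \<open>circle_integral_sqrt_ge\<close>). Summing over the coordinates gives
  \<open>smooth_l1_uniformly_psh_on_average\<close>.

  The gradient of an approximant has the components \<open>z\<^sub>j / sqrt (\<bar>z\<^sub>j\<bar>\<^sup>2 + e\<^sup>2)\<close>, of modulus at most 1.
  Near the boundary of the ball some coordinate has modulus at least \<open>1 / (2 n)\<close>, and for \<open>e \<le> 1\<close>
  the corresponding component is bounded away from 0.
\<close>

section \<open>The mean of a smoothed modulus over a small circle\<close>

text \<open>The quadratic Taylor polynomial of the square root at \<open>s\<^sup>2\<close> has the coefficient \<open>1/8\<close> where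
  this one has \<open>1/5\<close>. The larger value absorbs the cubic error also for negative \<open>t\<close>; it has to stay
  below \<open>1/4\<close> for the mean value estimate.\<close>
lemma sqrt_ge_taylor2:
  fixes s t :: real
  assumes "s > 0" and "\<bar>t\<bar> \<le> s\<^sup>2 / 2"
  shows "s + t / (2 * s) - t\<^sup>2 / (5 * s ^ 3) \<le> sqrt (s\<^sup>2 + t)"
proof -
  define u where "u = t / s\<^sup>2"
  have t: "t = s\<^sup>2 * u" using assms by (simp add: u_def)
  have u: "\<bar>u\<bar> \<le> 1 / 2" using assms by (simp add: u_def field_simps)
  have "u\<^sup>2 \<le> (1 / 2)\<^sup>2" using u by (metis abs_le_square_iff abs_of_nonneg zero_le_divide_1_iff zero_le_numeral)
  then have "u\<^sup>2 * (3 / 20 + u / 5 - u\<^sup>2 / 25) \<ge> 0"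
    using u by (intro mult_nonneg_nonneg) (auto simp: power2_eq_square)
  moreover have "(1 + u / 2 - u\<^sup>2 / 5)\<^sup>2 = 1 + u - u\<^sup>2 * (3 / 20 + u / 5 - u\<^sup>2 / 25)"
    by (simp add: power2_eq_square field_simps)
  ultimately have "1 + u / 2 - u\<^sup>2 / 5 \<le> sqrt (1 + u)"
    by (intro real_le_rsqrt) linarith
  then have "s * (1 + u / 2 - u\<^sup>2 / 5) \<le> s * sqrt (1 + u)"
    using assms(1) by (intro mult_left_mono) auto
  moreover have "s * sqrt (1 + u) = sqrt (s\<^sup>2 + t)"
  proof -
    have "s\<^sup>2 + t = s\<^sup>2 * (1 + u)" by (simp add: t algebra_simps)
    then show ?thesis using assms(1) by (simp add: real_sqrt_mult)
  qed
  moreover have "s * (1 + u / 2 - u\<^sup>2 / 5) = s + t / (2 * s) - t\<^sup>2 / (5 * s ^ 3)"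
    using assms(1) by (simp add: t field_simps power2_eq_square power3_eq_cube)
  ultimately show ?thesis by simp
qed

lemma has_integral_circle_linear_sq:
  fixes p q c :: real
  shows "((\<lambda>\<theta>. 2 * p * cos \<theta> + 2 * q * sin \<theta> + c) has_integral 2 * pi * c) {0..2*pi}" (is ?A)
    and "((\<lambda>\<theta>. (2 * p * cos \<theta> + 2 * q * sin \<theta> + c)\<^sup>2)
           has_integral 2 * pi * (2 * (p\<^sup>2 + q\<^sup>2) + c\<^sup>2)) {0..2*pi}" (is ?B)
proof -
  define F where "F \<theta> = 2 * p * sin \<theta> - 2 * q * cos \<theta> + c * \<theta>" for \<theta>
  have "((\<lambda>\<theta>. 2 * p * cos \<theta> + 2 * q * sin \<theta> + c) has_integral F (2*pi) - F 0) {0..2*pi}"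
    unfolding F_def
    by (rule fundamental_theorem_of_calculus)
       (auto intro!: derivative_eq_intros simp: has_real_derivative_iff_has_vector_derivative[symmetric])
  then show ?A by (simp add: F_def mult_ac)
  \<comment> \<open>An antiderivative: after expansion the cross terms of the square integrate to
      \<open>(sin \<theta>)\<^sup>2\<close>, \<open>sin \<theta>\<close> and \<open>cos \<theta>\<close>, and \<open>(cos \<theta>)\<^sup>2\<close>, \<open>(sin \<theta>)\<^sup>2\<close> to \<open>(\<theta> \<plusminus> sin \<theta> * cos \<theta>) / 2\<close>.\<close>
  define G where "G \<theta> = (2 * p\<^sup>2 + 2 * q\<^sup>2 + c\<^sup>2) * \<theta> + 2 * (p\<^sup>2 - q\<^sup>2) * (sin \<theta> * cos \<theta>)
      + 4 * p * q * (sin \<theta>)\<^sup>2 + 4 * c * p * sin \<theta> - 4 * c * q * cos \<theta>" for \<theta>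
  have "((\<lambda>\<theta>. (2 * p * cos \<theta> + 2 * q * sin \<theta> + c)\<^sup>2) has_integral G (2*pi) - G 0) {0..2*pi}"
  proof (rule fundamental_theorem_of_calculus)
    fix x assume "x \<in> {0..2 * pi}"
    have C: "(cos x)\<^sup>2 = 1 - (sin x)\<^sup>2" by (simp add: cos_squared_eq)
    have "(G has_real_derivative (2 * p * cos x + 2 * q * sin x + c)\<^sup>2) (at x within {0..2 * pi})"
      unfolding G_def
      apply (rule derivative_eq_intros refl)+
      using C by (simp add: power2_eq_square) algebra
    then show "(G has_vector_derivative (2 * p * cos x + 2 * q * sin x + c)\<^sup>2) (at x within {0..2 * pi})"
      by (simp add: has_real_derivative_iff_has_vector_derivative)
  qed simp
  then show ?B by (simp add: G_def algebra_simps)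
qed

text \<open>The minorant of the square root is integrated exactly. With \<open>\<bar>a\<bar> \<le> s\<close> and \<open>\<bar>b\<bar> \<le> s / 8\<close>, the
  linear term contributes \<open>\<bar>b\<bar>\<^sup>2 / (2 s)\<close> and the quadratic term costs at most \<open>9/10\<close> of that.\<close>
lemma circle_integral_sqrt_ge:
  fixes a b :: complex and e :: real
  assumes e: "e > 0" and b: "norm b \<le> e / 8"
  defines "s \<equiv> sqrt ((norm a)\<^sup>2 + e\<^sup>2)"
  shows "2 * pi * (s + (norm b)\<^sup>2 / (20 * s))
           \<le> integral {0..2*pi} (\<lambda>\<theta>. sqrt ((norm (a + cis \<theta> * b))\<^sup>2 + e\<^sup>2))"
proof -
  define p q where "p = Re (a * cnj b)" and "q = Im (a * cnj b)"
  define c where "c = (norm b)\<^sup>2"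
  define t where "t \<theta> = 2 * p * cos \<theta> + 2 * q * sin \<theta> + c" for \<theta>
  have s0: "s > 0" and s2: "s\<^sup>2 = (norm a)\<^sup>2 + e\<^sup>2"
    using e by (auto simp: s_def add_nonneg_pos)
  have as: "norm a \<le> s" unfolding s_def by (intro real_le_rsqrt) simp
  have es: "e \<le> s" unfolding s_def by (intro real_le_rsqrt) simp
  have bs: "norm b \<le> s / 8" using b es by simp
  have pq: "p\<^sup>2 + q\<^sup>2 = (norm a)\<^sup>2 * c"
    unfolding p_def q_def c_def by (metis cmod_power2 complex_mod_cnj norm_mult power_mult_distrib)
  have expand: "(norm (a + cis \<theta> * b))\<^sup>2 + e\<^sup>2 = s\<^sup>2 + t \<theta>" for \<theta>
  proof -
    have "(norm (a + cis \<theta> * b))\<^sup>2 = (norm a)\<^sup>2 + c * ((cos \<theta>)\<^sup>2 + (sin \<theta>)\<^sup>2) + 2 * p * cos \<theta> + 2 * q * sin \<theta>"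
      unfolding cmod_power2 c_def p_def q_def
      by (simp add: power2_eq_square algebra_simps
            del: sin_cos_squared_add sin_cos_squared_add2 sin_cos_squared_add3)
    then show ?thesis by (simp add: s2 t_def)
  qed
  \<comment> \<open>\<open>t\<close> is the difference of two squares of moduli that differ by at most \<open>\<bar>b\<bar>\<close>.\<close>
  have small: "\<bar>t \<theta>\<bar> \<le> s\<^sup>2 / 2" for \<theta>
  proof -
    have n: "norm (a + cis \<theta> * b) \<le> norm a + norm b" "norm a - norm b \<le> norm (a + cis \<theta> * b)"
      using norm_triangle_ineq[of a "cis \<theta> * b"] norm_diff_ineq[of a "cis \<theta> * b"]
      by (auto simp: norm_mult)
    have "\<bar>t \<theta>\<bar> = \<bar>norm (a + cis \<theta> * b) - norm a\<bar> * \<bar>norm (a + cis \<theta> * b) + norm a\<bar>"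
      unfolding abs_mult[symmetric] using expand[of \<theta>] s2
      by (simp add: power2_eq_square algebra_simps)
    also have "\<dots> \<le> (s / 8) * (s + s / 8 + s)"
      using n bs as s0 norm_ge_zero[of a] norm_ge_zero[of "a + cis \<theta> * b"]
      by (intro mult_mono abs_ge_zero) linarith+
    also have "\<dots> \<le> s\<^sup>2 / 2" using s0 by (simp add: power2_eq_square)
    finally show ?thesis .
  qed
  have lower: "((\<lambda>\<theta>. s + t \<theta> / (2 * s) - (t \<theta>)\<^sup>2 / (5 * s ^ 3)) has_integral
      2 * pi * s + (2 * pi * c) / (2 * s) - (2 * pi * (2 * (p\<^sup>2 + q\<^sup>2) + c\<^sup>2)) / (5 * s ^ 3)) {0..2*pi}"
    unfolding t_def divide_inverse
    using has_integral_const_real[of s 0 "2*pi"]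
    by (intro has_integral_diff has_integral_add has_integral_mult_left has_integral_circle_linear_sq)
       simp_all
  have cont: "(\<lambda>\<theta>. sqrt ((norm (a + cis \<theta> * b))\<^sup>2 + e\<^sup>2)) integrable_on {0..2*pi}"
    by (intro integrable_continuous_real continuous_intros)
  have "(norm a)\<^sup>2 \<le> s\<^sup>2" using as by (simp add: power_mono)
  moreover have "c \<le> s\<^sup>2 / 64"
    using power_mono[OF bs, of 2] by (simp add: c_def power_divide)
  ultimately have "2 * (p\<^sup>2 + q\<^sup>2) + c\<^sup>2 \<le> 2 * (s\<^sup>2 * c) + (s\<^sup>2 / 64) * c"
    unfolding pq power2_eq_square[of c]
    by (intro add_mono mult_mono mult_left_mono) (auto simp: c_def)
  also have "\<dots> \<le> s\<^sup>2 * c * (9 / 4)" by (simp add: c_def)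
  finally have "(2 * (p\<^sup>2 + q\<^sup>2) + c\<^sup>2) / (5 * s ^ 3) \<le> s\<^sup>2 * c * (9 / 4) / (5 * s ^ 3)"
    using s0 by (intro divide_right_mono) auto
  also have "\<dots> = c / (2 * s) - c / (20 * s)"
    using s0 by (simp add: field_simps power2_eq_square power3_eq_cube)
  finally have "2 * pi * (s + c / (20 * s)) \<le> 2 * pi * (s + c / (2 * s) - (2 * (p\<^sup>2 + q\<^sup>2) + c\<^sup>2) / (5 * s ^ 3))"
    by (intro mult_left_mono) auto
  also have "\<dots> = 2 * pi * s + (2 * pi * c) / (2 * s) - (2 * pi * (2 * (p\<^sup>2 + q\<^sup>2) + c\<^sup>2)) / (5 * s ^ 3)"
    by (simp add: algebra_simps)
  also have "\<dots> \<le> integral {0..2*pi} (\<lambda>\<theta>. sqrt ((norm (a + cis \<theta> * b))\<^sup>2 + e\<^sup>2))"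
    using lower integrable_integral[OF cont]
    by (rule has_integral_le) (use sqrt_ge_taylor2[OF s0 small] in \<open>simp add: expand\<close>)
  finally show ?thesis by (simp add: c_def)
qed

section \<open>Circle means of continuous functions\<close>

lemma ereal_integral_ereal:
  assumes "integrable M f"
  shows "ereal_integral M (\<lambda>x. ereal (f x)) = ereal (integral\<^sup>L M f)"
proof -
  have fin: "(\<integral>\<^sup>+ x. ennreal (f x) \<partial>M) < \<infinity>" "(\<integral>\<^sup>+ x. ennreal (- f x) \<partial>M) < \<infinity>"
    using assms by (simp_all add: real_integrable_def less_top)
  then show ?thesis
    unfolding ereal_integral_def real_lebesgue_integral_def[OF assms]
    by (cases "\<integral>\<^sup>+ x. ennreal (f x) \<partial>M"; cases "\<integral>\<^sup>+ x. ennreal (- f x) \<partial>M")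
       (auto simp: ennreal_def[symmetric] ennreal.abs_eq[symmetric] enn2ereal_ennreal)
qed

lemma circle_mean_continuous:
  fixes f :: "complex ^ 'n \<Rightarrow> real"
  assumes "continuous_on {0..2*pi} (\<lambda>\<theta>. f (a + cis \<theta> *s b))"
  shows "circle_mean (\<lambda>z. ereal (f z)) a b
           = ereal (integral {0..2*pi} (\<lambda>\<theta>. f (a + cis \<theta> *s b)) / (2 * pi))"
proof -
  let ?h = "\<lambda>\<theta>. f (a + cis \<theta> *s b)"
  have I: "set_integrable lborel {0..2*pi} ?h"
    using assms by (rule borel_integrable_atLeastAtMost')
  then have "integrable (restrict_space lborel {0..2*pi}) ?h"
    by (simp add: set_integrable_def integrable_restrict_space)
  moreover have "integral\<^sup>L (restrict_space lborel {0..2*pi}) ?h = integral {0..2*pi} ?h"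
    using set_borel_integral_eq_integral(2)[OF I]
    by (simp add: set_lebesgue_integral_def integral_restrict_space)
  ultimately show ?thesis
    by (simp add: circle_mean_def ereal_integral_ereal)
qed

section \<open>The \<open>l1\<close> norm and its smooth approximants\<close>

definition l1_norm :: "complex ^ 'n \<Rightarrow> real" where
  "l1_norm z = (\<Sum>j\<in>UNIV. norm (z $ j))"

definition smooth_l1 :: "real \<Rightarrow> complex ^ 'n \<Rightarrow> real" where
  "smooth_l1 e z = (\<Sum>j\<in>UNIV. sqrt ((norm (z $ j))\<^sup>2 + e\<^sup>2))"

lemma norm_complex_vector_mult:
  fixes b :: "complex ^ 'n"
  shows "norm (c *s b) = norm c * norm b"
  by (simp add: norm_vec_def vector_scalar_mult_def norm_mult L2_set_right_distrib)

lemma norm_vec_nth_le: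
  fixes z :: "complex ^ 'n"
  shows "norm (z $ j) \<le> norm z"
  unfolding norm_vec_def by (rule member_le_L2_set) simp_all

lemma norm_le_l1_norm: "norm z \<le> l1_norm z"
  unfolding norm_vec_def l1_norm_def by (rule L2_set_le_sum) simp

lemma norm_sq_complex_vector:
  fixes z :: "complex ^ 'n"
  shows "(norm z)\<^sup>2 = (\<Sum>j\<in>UNIV. (norm (z $ j))\<^sup>2)"
  by (simp add: norm_vec_def L2_set_def sum_nonneg)

lemma continuous_on_l1_norm [continuous_intros]:
  "continuous_on S f \<Longrightarrow> continuous_on S (\<lambda>x. l1_norm (f x))"
  unfolding l1_norm_def by (intro continuous_intros)

lemma continuous_on_smooth_l1 [continuous_intros]:
  "continuous_on S f \<Longrightarrow> continuous_on S (\<lambda>x. smooth_l1 e (f x))"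
  unfolding smooth_l1_def by (intro continuous_intros)

lemma GDERIV_smooth_l1:
  fixes z :: "complex ^ 'n"
  assumes "e \<noteq> 0"
  shows "GDERIV (smooth_l1 e) z :> (\<chi> j. z $ j /\<^sub>R sqrt ((norm (z $ j))\<^sup>2 + e\<^sup>2))"
proof -
  have pos: "z $ j \<bullet> z $ j + e\<^sup>2 > 0" for j
    using assms by (simp add: add_nonneg_pos)
  have "((\<lambda>z. sqrt (z $ j \<bullet> z $ j + e\<^sup>2)) has_derivative
          (\<lambda>h. h $ j \<bullet> (z $ j /\<^sub>R sqrt (z $ j \<bullet> z $ j + e\<^sup>2)))) (at z)" for j
    using pos[of j]
    by (auto intro!: derivative_eq_intros bounded_linear.has_derivative[OF bounded_linear_vec_nth]
             simp: fun_eq_iff inner_commute field_simps)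
  then have "((\<lambda>z. \<Sum>j\<in>UNIV. sqrt (z $ j \<bullet> z $ j + e\<^sup>2)) has_derivative
          (\<lambda>h. \<Sum>j\<in>UNIV. h $ j \<bullet> (z $ j /\<^sub>R sqrt (z $ j \<bullet> z $ j + e\<^sup>2)))) (at z)"
    by (rule has_derivative_sum)
  then show ?thesis
    by (simp add: gderiv_def smooth_l1_def[abs_def] inner_vec_def power2_norm_eq_inner)
qed

lemma GDERIV_imp_gradient:
  assumes "GDERIV f z :> D"
  shows "gradient f z = D"
  unfolding gradient_def
proof (rule the_equality)
  fix E assume "GDERIV f z :> E"
  then have "(\<lambda>h. inner h E) = (\<lambda>h. inner h D)"
    using assms unfolding gderiv_def by (rule has_derivative_unique)
  then show "E = D" by (metis vector_eq_ldot)
qed (rule assms)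

text \<open>The constant \<open>c\<close> is carried along because the approximants of the defining function
  are \<open>smooth_l1 e z - 1\<close>.\<close>
lemma
  fixes z :: "complex ^ 'n"
  assumes "e \<noteq> 0"
  shows gradient_smooth_l1:
      "gradient (\<lambda>z. smooth_l1 e z - c) z = (\<chi> j. z $ j /\<^sub>R sqrt ((norm (z $ j))\<^sup>2 + e\<^sup>2))"
    and differentiable_smooth_l1: "(\<lambda>z. smooth_l1 e z - c) differentiable (at z)"
proof -
  have D: "GDERIV (\<lambda>z. smooth_l1 e z - c) z :> (\<chi> j. z $ j /\<^sub>R sqrt ((norm (z $ j))\<^sup>2 + e\<^sup>2))"
    using GDERIV_diff[OF GDERIV_smooth_l1[OF assms] GDERIV_const] by simp
  show "gradient (\<lambda>z. smooth_l1 e z - c) z = (\<chi> j. z $ j /\<^sub>R sqrt ((norm (z $ j))\<^sup>2 + e\<^sup>2))"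
    using D by (rule GDERIV_imp_gradient)
  show "(\<lambda>z. smooth_l1 e z - c) differentiable (at z)"
    using D by (auto simp: gderiv_def differentiable_def)
qed

lemma C1_on_smooth_l1:
  assumes "e \<noteq> 0"
  shows "C1_on S (\<lambda>z :: complex ^ 'n. smooth_l1 e z - c)"
proof -
  have "(norm (z $ j))\<^sup>2 + e\<^sup>2 \<noteq> 0" for z :: "complex ^ 'n" and j
    using assms by (simp add: add_nonneg_eq_0_iff)
  then show ?thesis
    unfolding C1_on_def gradient_smooth_l1[OF assms, abs_def]
    using differentiable_smooth_l1[OF assms]
    by (auto intro!: continuous_intros)
qed

section \<open>Gradient bounds uniform in the smoothing parameter\<close>

lemma gradient_smooth_l1_le:
  fixes z :: "complex ^ 'n"
  assumes "e \<noteq> 0"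
  shows "norm (gradient (\<lambda>z. smooth_l1 e z - c) z) \<le> CARD('n)"
proof -
  have "norm (z $ j /\<^sub>R sqrt ((norm (z $ j))\<^sup>2 + e\<^sup>2)) \<le> 1" for j
  proof -
    have "norm (z $ j) \<le> sqrt ((norm (z $ j))\<^sup>2 + e\<^sup>2)" by (rule real_le_rsqrt) simp
    moreover have "sqrt ((norm (z $ j))\<^sup>2 + e\<^sup>2) > 0" using assms by (simp add: add_nonneg_pos)
    ultimately show ?thesis by (simp add: divide_inverse_commute[symmetric] del: real_sqrt_gt_0_iff)
  qed
  then have "l1_norm (\<chi> j. z $ j /\<^sub>R sqrt ((norm (z $ j))\<^sup>2 + e\<^sup>2)) \<le> CARD('n)"
    unfolding l1_norm_def using sum_bounded_above[of "UNIV :: 'n set" _ "1 :: real"] by simp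
  then show ?thesis
    using norm_le_l1_norm order_trans unfolding gradient_smooth_l1[OF assms] by blast
qed

text \<open>A coordinate at least as large as the average satisfies \<open>\<bar>z\<^sub>j\<bar> \<ge> 1 / (2 n)\<close>, and already its
  component \<open>\<bar>z\<^sub>j\<bar> / sqrt (\<bar>z\<^sub>j\<bar>\<^sup>2 + e\<^sup>2) \<ge> \<bar>z\<^sub>j\<bar> / (\<bar>z\<^sub>j\<bar> + 1)\<close> of the gradient is large enough.\<close>
lemma gradient_smooth_l1_ge:
  fixes z :: "complex ^ 'n"
  assumes e: "0 < e" "e \<le> 1" and z: "l1_norm z \<ge> 1 / 2"
  shows "norm (gradient (\<lambda>z. smooth_l1 e z - c) z) \<ge> 1 / (1 + 2 * CARD('n))"
proof -
  let ?N = "real CARD('n)"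
  obtain j where j: "norm (z $ j) \<ge> 1 / (2 * ?N)"
  proof (rule ccontr)
    assume "\<not> thesis"
    then have "norm (z $ j) < 1 / (2 * ?N)" for j
      using that by (meson not_le)
    then have "l1_norm z < (\<Sum>j\<in>(UNIV :: 'n set). 1 / (2 * ?N))"
      unfolding l1_norm_def by (intro sum_strict_mono) auto
    with z show False by simp
  qed
  define x where "x = norm (z $ j)"
  have x: "x > 0" "1 \<le> 2 * ?N * x"
    using j by (auto simp: x_def divide_simps mult_ac intro: less_le_trans[of 0 "1 / (2 * ?N)"])
  have "sqrt (x\<^sup>2 + e\<^sup>2) \<le> x + e"
    using sqrt_add_le_add_sqrt[of "x\<^sup>2" "e\<^sup>2"] x e by simp
  also have "\<dots> \<le> x * (1 + 2 * ?N)" using e x by (simp add: algebra_simps)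
  finally have "1 / (1 + 2 * ?N) \<le> x / sqrt (x\<^sup>2 + e\<^sup>2)"
    using x e by (simp add: divide_simps add_pos_pos mult_ac)
  also have "\<dots> = norm ((\<chi> j. z $ j /\<^sub>R sqrt ((norm (z $ j))\<^sup>2 + e\<^sup>2)) $ j)"
    by (simp add: x_def divide_inverse_commute)
  also have "\<dots> \<le> norm (gradient (\<lambda>z. smooth_l1 e z - c) z)"
    using e by (simp only: gradient_smooth_l1 norm_vec_nth_le less_imp_neq[symmetric] not_False_eq_True)
  finally show ?thesis by simp
qed

section \<open>Uniform plurisubharmonicity of the approximants\<close>

text \<open>The one-variable estimate is applied to every coordinate; the gain
  \<open>\<bar>b\<^sub>j\<bar>\<^sup>2 / (20 sqrt (\<bar>a\<^sub>j\<bar>\<^sup>2 + e\<^sup>2))\<close> is made independent of \<open>j\<close> and \<open>e\<close> by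
  \<open>sqrt (\<bar>a\<^sub>j\<bar>\<^sup>2 + e\<^sup>2) \<le> R + 1\<close>.\<close>
lemma circle_mean_smooth_l1_ge:
  fixes a b :: "complex ^ 'n"
  assumes e: "0 < e" "e \<le> 1" and a: "norm a \<le> R" and b: "norm b \<le> e / 8"
  shows "ereal ((norm b)\<^sup>2 / (20 * (R + 1)) + (smooth_l1 e a - c))
           \<le> circle_mean (\<lambda>z. ereal (smooth_l1 e z - c)) a b"
proof -
  let ?s = "\<lambda>j. sqrt ((norm (a $ j))\<^sup>2 + e\<^sup>2)"
  let ?f = "\<lambda>\<theta> j. sqrt ((norm (a $ j + cis \<theta> * b $ j))\<^sup>2 + e\<^sup>2)"
  have s: "0 < ?s j" "?s j \<le> R + 1" for j
  proof -
    show "0 < ?s j" using e by (simp add: add_nonneg_pos)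
    show "?s j \<le> R + 1"
      using sqrt_add_le_add_sqrt[of "(norm (a $ j))\<^sup>2" "e\<^sup>2"] norm_vec_nth_le[of a j] a e by simp
  qed
  have "(norm b)\<^sup>2 / (20 * (R + 1)) + smooth_l1 e a
      = (\<Sum>j\<in>UNIV. ?s j + (norm (b $ j))\<^sup>2 / (20 * (R + 1)))"
    by (simp add: norm_sq_complex_vector smooth_l1_def sum.distrib sum_divide_distrib)
  also have "\<dots> \<le> (\<Sum>j\<in>UNIV. ?s j + (norm (b $ j))\<^sup>2 / (20 * ?s j))"
    using s by (intro sum_mono add_left_mono divide_left_mono mult_left_mono mult_pos_pos)
               (auto intro: less_le_trans simp del: real_sqrt_gt_0_iff)
  finally have "2 * pi * ((norm b)\<^sup>2 / (20 * (R + 1)) + smooth_l1 e a)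
      \<le> (\<Sum>j\<in>UNIV. 2 * pi * (?s j + (norm (b $ j))\<^sup>2 / (20 * ?s j)))"
    by (simp flip: sum_distrib_left)
  also have "\<dots> \<le> (\<Sum>j\<in>UNIV. integral {0..2*pi} (\<lambda>\<theta>. ?f \<theta> j))"
    using e b norm_vec_nth_le[of b] order_trans
    by (intro sum_mono circle_integral_sqrt_ge) blast+
  also have "\<dots> = integral {0..2*pi} (\<lambda>\<theta>. smooth_l1 e (a + cis \<theta> *s b))"
    unfolding smooth_l1_def
    by (subst integral_sum) (auto intro!: integrable_continuous_real continuous_intros)
  also have "\<dots> = integral {0..2*pi} (\<lambda>\<theta>. smooth_l1 e (a + cis \<theta> *s b) - c) + 2 * pi * c"
    unfolding vector_scalar_mult_def
    by (subst integral_diff) (auto intro!: integrable_continuous_real continuous_intros)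
  finally have "(norm b)\<^sup>2 / (20 * (R + 1)) + (smooth_l1 e a - c)
      \<le> integral {0..2*pi} (\<lambda>\<theta>. smooth_l1 e (a + cis \<theta> *s b) - c) / (2 * pi)"
    by (simp add: field_simps)
  moreover have "continuous_on {0..2*pi} (\<lambda>\<theta>. smooth_l1 e (a + cis \<theta> *s b) - c)"
    unfolding vector_scalar_mult_def by (intro continuous_intros)
  ultimately show ?thesis
    by (simp add: circle_mean_continuous)
qed

lemma continuous_on_imp_usc_on:
  fixes g :: "'a::topological_space \<Rightarrow> 'b::order_topology"
  assumes "continuous_on U g"
  shows "usc_on U g"
  unfolding usc_on_def
  using continuous_openin_preimage_gen[OF assms open_lessThan]
  by (simp add: vimage_def Int_def)

lemma continuous_on_imp_lsc_on:
  fixes g :: "'a::topological_space \<Rightarrow> 'b::order_topology"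
  assumes "continuous_on U g"
  shows "lsc_on U g"
  unfolding lsc_on_def
  using continuous_openin_preimage_gen[OF assms open_greaterThan]
  by (simp add: vimage_def Int_def)

lemma smooth_l1_uniformly_psh_on_average:
  assumes e: "0 < e" "e \<le> 1" and R: "R > 0"
  shows "uniformly_psh_on_average (1 / (20 * (R + 1))) (ball (0 :: complex ^ 'n) R)
           (\<lambda>z. ereal (smooth_l1 e z - c))"
proof -
  \<comment> \<open>\<open>e / 8\<close> is the range of the circle estimate; \<open>R - norm a\<close> keeps the disk inside the ball.\<close>
  define \<delta> where "\<delta> a = min (e / 8) (R - norm a)" for a :: "complex ^ 'n"
  have "continuous_on (ball 0 R) \<delta>"
    unfolding \<delta>_def by (intro continuous_intros)
  moreover have "continuous_on (ball 0 R) (\<lambda>z :: complex ^ 'n. ereal (smooth_l1 e z - c))"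
    by (intro continuous_intros)
  moreover have "(\<lambda>\<zeta>. a + \<zeta> *s b) ` cball 0 1 \<subseteq> ball 0 R" if "norm b < \<delta> a" for a b
  proof clarsimp
    fix \<zeta> :: complex assume "norm \<zeta> \<le> 1"
    then have "norm (\<zeta> *s b) \<le> norm b"
      by (simp add: norm_complex_vector_mult mult_left_le_one_le)
    then show "norm (a + \<zeta> *s b) < R"
      using norm_triangle_ineq[of a "\<zeta> *s b"] that by (simp add: \<delta>_def)
  qed
  moreover have "ereal (1 / (20 * (R + 1)) * (norm b)\<^sup>2) + ereal (smooth_l1 e a - c)
      \<le> circle_mean (\<lambda>z. ereal (smooth_l1 e z - c)) a b"
    if "a \<in> ball 0 R" "norm b < \<delta> a" for a b
    using circle_mean_smooth_l1_ge[OF e, of a R b c] that by (simp add: \<delta>_def)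
  moreover have "\<delta> a > 0" if "a \<in> ball 0 R" for a
    using that e by (simp add: \<delta>_def)
  ultimately show ?thesis
    unfolding uniformly_psh_on_average_def using R
    by (intro conjI exI[of _ \<delta>]) (auto intro: continuous_on_imp_usc_on continuous_on_imp_lsc_on)
qed

section \<open>The unit ball of the \<open>l1\<close> norm\<close>

lemma smooth_l1_tendsto:
  "(\<lambda>m. smooth_l1 (inverse (real (Suc m))) z) \<longlonglongrightarrow> l1_norm z"
proof -
  have "(\<lambda>m. smooth_l1 (inverse (real (Suc m))) z) \<longlonglongrightarrow> (\<Sum>j\<in>UNIV. sqrt ((norm (z $ j))\<^sup>2 + 0\<^sup>2))"
    unfolding smooth_l1_def by (intro tendsto_intros LIMSEQ_inverse_real_of_nat)
  then show ?thesis by (simp add: l1_norm_def)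
qed

lemma convex_l1_ball: "convex {z. l1_norm z < 1}"
proof (rule convexI, clarify)
  fix x y :: "complex ^ 'n" and u v :: real
  assume *: "l1_norm x < 1" "l1_norm y < 1" "0 \<le> u" "0 \<le> v" "u + v = 1"
  have "l1_norm (u *\<^sub>R x + v *\<^sub>R y) \<le> (\<Sum>j\<in>UNIV. u * norm (x $ j) + v * norm (y $ j))"
    unfolding l1_norm_def using * by (intro sum_mono) (simp add: norm_triangle_le)
  also have "\<dots> = u * l1_norm x + v * l1_norm y"
    by (simp add: l1_norm_def sum.distrib sum_distrib_left)
  also have "\<dots> < 1" using * by (intro convex_bound_lt)
  finally show "l1_norm (u *\<^sub>R x + v *\<^sub>R y) < 1" .
qed

theorem corollary3p18:
  shows "zero_uniformly_pseudoconvex {z :: complex ^ 'n. (\<Sum>j\<in>UNIV. norm (z $ j)) < 1}"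
proof -
  \<comment> \<open>The outer neighbourhood \<open>ball 0 4\<close> contains the whole domain. The inner one must avoid the
      origin, where the gradients of the approximants vanish.\<close>
  define U where "U = {z :: complex ^ 'n. l1_norm z < 1}"
  define V1 where "V1 = {z :: complex ^ 'n. 1 / 2 < l1_norm z \<and> l1_norm z < 2}"
  define rs where "rs m z = smooth_l1 (inverse (real (Suc m))) z - 1" for m and z :: "complex ^ 'n"
  have eps: "0 < inverse (real (Suc m))" "inverse (real (Suc m)) \<le> 1" for m
    by (auto simp: divide_simps)
  have openU: "open U" and openV1: "open V1"
    unfolding U_def V1_def by (intro open_Collect_less open_Collect_conj continuous_intros)+
  have clU: "closure U \<subseteq> {z. l1_norm z \<le> 1}"
    unfolding U_def by (intro closure_minimal closed_Collect_le continuous_intros) auto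
  then have frU: "frontier U \<subseteq> {z. l1_norm z = 1}"
    using openU by (auto simp: frontier_def interior_open U_def)
  have clV1: "closure V1 \<subseteq> {z. 1 / 2 \<le> l1_norm z \<and> l1_norm z \<le> 2}"
    unfolding V1_def
    by (intro closure_minimal closed_Collect_le closed_Collect_conj continuous_intros) auto
  have ball: "z \<in> ball 0 4" if "l1_norm z < 4" for z :: "complex ^ 'n"
    using that norm_le_l1_norm[of z] by simp
  have tends: "(\<lambda>m. rs m z) \<longlonglongrightarrow> l1_norm z - 1" for z
    unfolding rs_def by (intro tendsto_intros smooth_l1_tendsto)
  have "zero_uniformly_pseudoconvex U"
    unfolding zero_uniformly_pseudoconvex_def
  proof (intro conjI exI ballI allI)
    show "connected U"
      unfolding U_def by (intro convex_connected convex_l1_ball)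
    have "0 \<in> U" by (simp add: U_def l1_norm_def)
    then show "U \<noteq> {}" by blast
    have "U \<subseteq> ball 0 4" using ball by (auto simp: U_def)
    then show "compact (closure U)"
      by (simp add: bounded_subset[OF bounded_ball])
    show "bounded V1"
      using ball by (intro bounded_subset[OF bounded_ball, of _ 0 4]) (auto simp: V1_def)
    show "frontier U \<subseteq> V1" "frontier U \<subseteq> ball 0 4"
      using frU ball by (force simp: V1_def)+
    show "closure V1 \<subseteq> ball 0 4" using clV1 ball by force
    show "U \<inter> ball 0 4 = {z \<in> ball 0 4. l1_norm z - 1 < 0}" by (auto simp: U_def)
    show "(\<lambda>m. rs m z) \<longlonglongrightarrow> l1_norm z - 1" for z by (rule tends)
    show "bounded (range (\<lambda>m. rs m z))" for z
      using tends by (rule convergent_imp_bounded)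
    show "C1_on (ball 0 4) (rs m)" for m
      unfolding rs_def using eps[of m] by (intro C1_on_smooth_l1) auto
    show "uniformly_psh_on_average (1 / (20 * (4 + 1))) (ball 0 4) (\<lambda>z. ereal (rs m z))" for m
      unfolding rs_def by (intro smooth_l1_uniformly_psh_on_average eps) simp
    show "norm (gradient (rs m) z) \<le> CARD('n)" for m z
      unfolding rs_def using eps[of m] by (intro gradient_smooth_l1_le) auto
    show "1 / (1 + 2 * CARD('n)) \<le> norm (gradient (rs m) z)" if "z \<in> closure V1" for m z
      unfolding rs_def using that clV1 by (intro gradient_smooth_l1_ge eps) auto
  qed (auto simp: openU openV1 add_pos_pos)
  then show ?thesis by (simp add: U_def l1_norm_def)
qed

end
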